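(* Let $(X,\Sigma_X)$ and $(Y,\Sigma_Y)$ be measurable spaces, $\mu$ a probability measure on $X$, $\mathcal{V}:X\times\Sigma_Y\to[0,1]$ a Markov kernel, and $\mathcal{M}(dq,dv)=\mathcal{V}(q,dv)\,\mu(dq)$ the associated probability measure on $X\times Y$. Let $p\ge 1$, set $S_0:=I$, and let $S_j:X\times Y\to X\times Y$, $j=1,\dots,p$, be measurable mappings with $S_j\circ S_j=I$ and $S_j^*\mathcal{M}\ll\mathcal{M}$. Let $\overline{\alpha}_j\ge 0$, $j=1,\dots,p$, be weights with $\sum_{j=1}^p\overline{\alpha}_j\le 1$. Define $\alpha_j:X\times Y\to[0,1]$ by $$\alpha_j(q,v):=\overline{\alpha}_j\Big[1\wedge\frac{dS_j^*\mathcal{M}}{d\mathcal{M}}(q,v)\Big],\quad j=1,\dots,p,\qquad \alpha_0(q,v):=1-\sum_{j=1}^p\alpha_j(q,v),$$ for all $(q,v)\in X\times Y$. Then $\sum_{j=0}^p\int_Y\alpha_j(q,v)\,\mathcal{V}(q,dv)=1$ for every $q\in X$; for every $j=0,\dots,p$, $$\alpha_j(S_j(q,v))\,S_j^*\mathcal{M}(dq,dv)=\alpha_j(q,v)\,\mathcal{M}(dq,dv);$$ and $\sum_{j=0}^p\int_Y \alpha_j(S_j(q,v))\,S_j^*\mathcal{M}(dq,dv)=\mu(dq)$. Consequently, the Markov kernel $$P^{\alpha,S,\mathcal{V}}(q,d\tilde q)=\sum_{j=0}^p\int_Y\alpha_j(q,v)\,\delta_{\Pi_1 S_j(q,v)}(d\tilde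 q)\,\mathcal{V}(q,dv)$$ satisfies detailed balance with respect to $\mu$, i.e. $P^{\alpha,S,\mathcal{V}}(q,d\tilde q)\,\mu(dq)=P^{\alpha,S,\mathcal{V}}(\tilde q,dq)\,\mu(d\tilde q)$, and thus $\mu P^{\alpha,S,\mathcal{V}}=\mu$.
   Context: A Markov kernel $\mathcal{V}:X\times\Sigma_Y\to[0,1]$ is a map such that $\mathcal{V}(q,\cdot)$ is a probability measure on $Y$ for each $q$ and $q\mapsto\mathcal{V}(q,E)$ is measurable for each $E\in\Sigma_Y$. $\Pi_1(q,v)=q$. $\phi^*\nu$ denotes the pushforward of the measure $\nu$ by $\phi$: $\phi^*\nu(E)=\nu(\phi^{-1}(E))$. $d\nu/d\rho$ denotes (a fixed nonnegative version of) the Radon–Nikodym derivative. $a\wedge b=\min(a,b)$. $\mu P(d\tilde q)=\int_X P(q,d\tilde q)\,\mu(dq)$. *)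

theory Defs
  imports "HOL-Probability.Probability"
begin

text \<open>
  A Markov kernel from X to Y is an element of \<open>X \<rightarrow>\<^sub>M prob_algebra Y\<close>, and a probability measure on
  X is an element of \<open>space (prob_algebra X)\<close>. The first lemma unfolds the former.
\<close>

lemma markov_kernel_iff:
  "V \<in> X \<rightarrow>\<^sub>M prob_algebra Y \<longleftrightarrow>
     (\<forall>q\<in>space X. prob_space (V q) \<and> sets (V q) = sets Y) \<and>
     (\<forall>E\<in>sets Y. (\<lambda>q. emeasure (V q) E) \<in> borel_measurable X)"
proof
  assume V: "V \<in> X \<rightarrow>\<^sub>M prob_algebra Y"
  then have "V \<in> X \<rightarrow>\<^sub>M subprob_algebra Y"
    by (rule measurable_prob_algebraD)
  with measurable_space[OF V] measurable_emeasure_kernel[of V X Y]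
  show "(\<forall>q\<in>space X. prob_space (V q) \<and> sets (V q) = sets Y) \<and>
     (\<forall>E\<in>sets Y. (\<lambda>q. emeasure (V q) E) \<in> borel_measurable X)"
    by (auto simp: space_prob_algebra)
next
  assume V: "(\<forall>q\<in>space X. prob_space (V q) \<and> sets (V q) = sets Y) \<and>
     (\<forall>E\<in>sets Y. (\<lambda>q. emeasure (V q) E) \<in> borel_measurable X)"
  show "V \<in> X \<rightarrow>\<^sub>M prob_algebra Y"
    using V by (intro measurable_prob_algebraI measurable_subprob_algebra)
      (auto intro: prob_space_imp_subprob_space)
qed

text \<open>The measure \<open>V(q,dv) \<mu>(dq)\<close> on the product of X and Y.\<close>

definition joint_measure ::
    "'a measure \<Rightarrow> 'b measure \<Rightarrow> 'a measure \<Rightarrow> ('a \<Rightarrow> 'b measure) \<Rightarrow> ('a \<times> 'b) measure" where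
  "joint_measure X Y mu V =
     mu \<bind> (\<lambda>q. V q \<bind> (\<lambda>v. return (X \<Otimes>\<^sub>M Y) (q, v)))"

lemma joint_measure_in_prob_algebra:
  assumes mu: "mu \<in> space (prob_algebra X)" and V[measurable]: "V \<in> X \<rightarrow>\<^sub>M prob_algebra Y"
  shows "joint_measure X Y mu V \<in> space (prob_algebra (X \<Otimes>\<^sub>M Y))"
proof -
  have "(\<lambda>m. m \<bind> (\<lambda>q. V q \<bind> (\<lambda>v. return (X \<Otimes>\<^sub>M Y) (q, v))))
          \<in> prob_algebra X \<rightarrow>\<^sub>M prob_algebra (X \<Otimes>\<^sub>M Y)"
    by measurable
  from measurable_space[OF this mu] show ?thesis
    by (simp add: joint_measure_def)
qed

lemma emeasure_joint_measure:
  assumes mu: "mu \<in> space (prob_algebra X)" and V[measurable]: "V \<in> X \<rightarrow>\<^sub>M prob_algebra Y"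
    and E[measurable]: "E \<in> sets (X \<Otimes>\<^sub>M Y)"
  shows "emeasure (joint_measure X Y mu V) E = (\<integral>\<^sup>+q. \<integral>\<^sup>+v. indicator E (q, v) \<partial>V q \<partial>mu)"
proof -
  have mu_sets: "sets mu = sets X" and mu_space: "space mu = space X"
    using mu by (auto simp: space_prob_algebra dest: sets_eq_imp_space_eq)
  have "emeasure (joint_measure X Y mu V) E =
      (\<integral>\<^sup>+q. emeasure (V q \<bind> (\<lambda>v. return (X \<Otimes>\<^sub>M Y) (q, v))) E \<partial>mu)"
    unfolding joint_measure_def
    by (rule emeasure_bind_prob_algebra[OF mu]) measurable
  also have "\<dots> = (\<integral>\<^sup>+q. \<integral>\<^sup>+v. indicator E (q, v) \<partial>V q \<partial>mu)"
  proof (rule nn_integral_cong)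
    fix q assume "q \<in> space mu"
    then have q[measurable]: "q \<in> space X" by (simp add: mu_space)
    have Vq: "V q \<in> space (prob_algebra Y)" using measurable_space[OF V q] .
    show "emeasure (V q \<bind> (\<lambda>v. return (X \<Otimes>\<^sub>M Y) (q, v))) E = (\<integral>\<^sup>+v. indicator E (q, v) \<partial>V q)"
      by (subst emeasure_bind_prob_algebra[OF Vq, where L = "X \<Otimes>\<^sub>M Y"])
        (auto intro!: nn_integral_cong)
  qed
  finally show ?thesis .
qed

text \<open>
  f is a version of the Radon--Nikodym derivative dN/dM. \<open>RN_deriv M N\<close> is one particular version (see
  the lemma below); results stated for an arbitrary version cover it.
\<close>

definition RN_version :: "'c measure \<Rightarrow> 'c measure \<Rightarrow> ('c \<Rightarrow> ennreal) \<Rightarrow> bool" where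
  "RN_version M N f \<longleftrightarrow> f \<in> borel_measurable M \<and> density M f = N"

lemma RN_version_RN_deriv:
  assumes "prob_space M" "absolutely_continuous M N" "sets N = sets M"
  shows "RN_version M N (RN_deriv M N)"
proof -
  interpret prob_space M by fact
  show ?thesis
    using assms density_RN_deriv by (simp add: RN_version_def)
qed

text \<open>
  \<open>D j\<close> plays the role of \<open>d(S\<^sub>j\<^sup>*M)/dM\<close>. Versions may take the value \<open>\<infinity>\<close> (on a null set only);
  the minimum with 1 is taken before passing to the reals, so it is 1 there.
\<close>

definition accept_prob ::
    "nat \<Rightarrow> (nat \<Rightarrow> real) \<Rightarrow> (nat \<Rightarrow> 'c \<Rightarrow> ennreal) \<Rightarrow> nat \<Rightarrow> 'c \<Rightarrow> real" where
  "accept_prob p abar D j z =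
     (if j = 0 then 1 - (\<Sum>i=1..p. abar i * enn2real (min 1 (D i z)))
      else abar j * enn2real (min 1 (D j z)))"

text \<open>
  The kernel \<open>P(q,A) = \<Sum>\<^sub>j \<integral> \<alpha>\<^sub>j(q,v) \<delta>\<^bsub>\<Pi>\<^sub>1 S\<^sub>j(q,v)\<^esub>(A) V(q,dv)\<close>, with \<open>return X x\<close> the Dirac measure
  at x.
\<close>

definition P_kernel ::
    "'a measure \<Rightarrow> nat \<Rightarrow> (nat \<Rightarrow> 'a \<times> 'b \<Rightarrow> real) \<Rightarrow> (nat \<Rightarrow> 'a \<times> 'b \<Rightarrow> 'a \<times> 'b) \<Rightarrow>
     ('a \<Rightarrow> 'b measure) \<Rightarrow> 'a \<Rightarrow> 'a measure" where
  "P_kernel X p \<alpha> S V q =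
     measure_of (space X) (sets X)
       (\<lambda>A. \<Sum>j=0..p. \<integral>\<^sup>+v. ennreal (\<alpha> j (q, v)) * emeasure (return X (fst (S j (q, v)))) A \<partial>V q)"

lemma emeasure_P_kernel:
  assumes V[measurable]: "V \<in> X \<rightarrow>\<^sub>M prob_algebra Y"
    and S[measurable]: "\<And>j. j \<le> p \<Longrightarrow> S j \<in> (X \<Otimes>\<^sub>M Y) \<rightarrow>\<^sub>M (X \<Otimes>\<^sub>M Y)"
    and a[measurable]: "\<And>j. j \<le> p \<Longrightarrow> \<alpha> j \<in> borel_measurable (X \<Otimes>\<^sub>M Y)"
    and q[measurable]: "q \<in> space X" and A[measurable]: "A \<in> sets X"
  shows "emeasure (P_kernel X p \<alpha> S V q) A =
    (\<Sum>j=0..p. \<integral>\<^sup>+v. ennreal (\<alpha> j (q, v)) * emeasure (return X (fst (S j (q, v)))) A \<partial>V q)"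
proof -
  have [measurable_cong]: "sets (V q) = sets Y"
    using measurable_space[OF V q] by (simp add: space_prob_algebra)
  have Sj[measurable]: "(\<lambda>v. fst (S j (q, v))) \<in> Y \<rightarrow>\<^sub>M X" if "j \<le> p" for j
    using S[OF that] by measurable
  have aj[measurable]: "(\<lambda>v. \<alpha> j (q, v)) \<in> borel_measurable Y" if "j \<le> p" for j
    using a[OF that] by measurable
  show ?thesis
    unfolding P_kernel_def
  proof (rule emeasure_measure_of_sigma[OF sets.sigma_algebra_axioms _ _ A])
    show "positive (sets X) (\<lambda>A. \<Sum>j=0..p. \<integral>\<^sup>+v. ennreal (\<alpha> j (q, v)) *
        emeasure (return X (fst (S j (q, v)))) A \<partial>V q)"
      by (simp add: positive_def)
    show "countably_additive (sets X) (\<lambda>A. \<Sum>j=0..p. \<integral>\<^sup>+v. ennreal (\<alpha> j (q, v)) *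
        emeasure (return X (fst (S j (q, v)))) A \<partial>V q)"
    proof (rule countably_additiveI)
      fix F :: "nat \<Rightarrow> 'a set"
      assume F: "range F \<subseteq> sets X" and dis: "disjoint_family F"
      have Fi[measurable]: "F i \<in> sets X" for i using F by auto
      have m: "(\<lambda>v. ennreal (\<alpha> j (q, v)) * emeasure (return X (fst (S j (q, v)))) (F i))
          \<in> borel_measurable (V q)" if j[simp]: "j \<le> p" for i j
        using Sj[OF j] aj[OF j] by simp
      have "(\<Sum>i. \<Sum>j=0..p. \<integral>\<^sup>+v. ennreal (\<alpha> j (q, v)) *
              emeasure (return X (fst (S j (q, v)))) (F i) \<partial>V q)
          = (\<Sum>j=0..p. \<Sum>i. \<integral>\<^sup>+v. ennreal (\<alpha> j (q, v)) *
              emeasure (return X (fst (S j (q, v)))) (F i) \<partial>V q)"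
        by (intro suminf_sum) auto
      also have "\<dots> = (\<Sum>j=0..p. \<integral>\<^sup>+v. (\<Sum>i. ennreal (\<alpha> j (q, v)) *
              emeasure (return X (fst (S j (q, v)))) (F i)) \<partial>V q)"
        using m by (intro sum.cong refl nn_integral_suminf[symmetric]) auto
      also have "\<dots> = (\<Sum>j=0..p. \<integral>\<^sup>+v. ennreal (\<alpha> j (q, v)) *
              emeasure (return X (fst (S j (q, v)))) (\<Union>i. F i) \<partial>V q)"
        using F dis by (simp add: suminf_indicator)
      finally show "(\<Sum>i. \<Sum>j=0..p. \<integral>\<^sup>+v. ennreal (\<alpha> j (q, v)) *
              emeasure (return X (fst (S j (q, v)))) (F i) \<partial>V q)
          = (\<Sum>j=0..p. \<integral>\<^sup>+v. ennreal (\<alpha> j (q, v)) *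
              emeasure (return X (fst (S j (q, v)))) (\<Union>i. F i) \<partial>V q)" .
    qed
  qed
qed

text \<open>
  \<open>P(x,dy) \<mu>(dx) = P(y,dx) \<mu>(dy)\<close> as measures on the product of X with itself; the right-hand side
  is the left-hand side pushed forward by the swap of coordinates.
\<close>

definition detailed_balance :: "'a measure \<Rightarrow> 'a measure \<Rightarrow> ('a \<Rightarrow> 'a measure) \<Rightarrow> bool" where
  "detailed_balance X mu P \<longleftrightarrow>
     joint_measure X X mu P =
     distr (joint_measure X X mu P) (X \<Otimes>\<^sub>M X) (\<lambda>(x, y). (y, x))"

end

theory Submission
  imports Defs
begin

text \<open>
  If S is an involution and D is a density of its pushforward of M, then applying S twice gives
  \<open>D \<cdot> (D \<circ> S) = 1\<close> almost everywhere, so \<open>D \<cdot> (1 \<and> D \<circ> S) = 1 \<and> D\<close>, which is the balance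
  identity for each \<open>\<alpha>\<^sub>j\<close>. Hence \<open>\<integral> \<alpha>\<^sub>j(z) g(S\<^sub>j z) M(dz) = \<integral> \<alpha>\<^sub>j(z) g(z) M(dz)\<close> for all nonnegative g. With
  \<open>g(z) = 1\<^sub>E(\<Pi>\<^sub>1 S\<^sub>j z, \<Pi>\<^sub>1 z)\<close> this exchanges the two coordinates of \<open>P(x,dy) \<mu>(dx)\<close>.
\<close>

section \<open>Involutions and the densities of their pushforwards\<close>

text \<open>Multiplication by \<open>c\<close> is monotone on \<open>ennreal\<close>, also for
  infinite \<open>c\<close>, so it respects whichever argument is smaller. It serves to move a
  factor \<open>D z\<close> inside a minimum without first excluding infinite values.\<close>

lemma mult_min_ennreal: "c * min a b = min (c * a) (c * b)" for a b c :: ennreal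
  by (cases "a \<le> b") (auto simp: min_def intro!: antisym mult_left_mono dest: mult_left_mono[of _ _ c])

text \<open>Weighting the pushforward by \<open>D (S z)\<close> amounts to pushing forward a second
  time, and two pushes by an involution return \<open>M\<close>. So \<open>M\<close> has both the
  product and the constant 1 as a density with respect to itself, and sigma-finiteness makes
  densities unique up to null sets.\<close>

lemma AE_involution_density:
  assumes M: "sigma_finite_measure M"
    and S[measurable]: "S \<in> M \<rightarrow>\<^sub>M M"
    and inv: "\<And>z. z \<in> space M \<Longrightarrow> S (S z) = z"
    and D[measurable]: "D \<in> borel_measurable M"
    and dens: "density M D = distr M M S"
  shows "AE z in M. D z * D (S z) = 1"
proof -
  have "density M (\<lambda>z. D z * D (S z)) = density (density M D) (\<lambda>z. D (S z))"
    by (rule density_density_eq[symmetric]) measurable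
  also have "\<dots> = density (distr M M S) (\<lambda>z. D (S z))"
    by (simp only: dens)
  also have "\<dots> = distr (density M (\<lambda>z. D (S (S z)))) M S"
    by (subst density_distr) auto
  also have "density M (\<lambda>z. D (S (S z))) = density M D"
    by (intro density_cong) (auto simp: inv)
  also have "\<dots> = distr M M S"
    by (rule dens)
  also have "distr (distr M M S) M S = distr M M (S \<circ> S)"
    by (rule distr_distr[OF S S])
  also have "\<dots> = distr M M (\<lambda>z. z)"
    by (intro distr_cong) (auto simp: inv)
  also have "\<dots> = density M (\<lambda>_. 1)"
    by (simp add: distr_id2 density_1)
  finally show ?thesis
    by (intro sigma_finite_measure.density_unique[OF M]) auto
qed

text \<open>The balance identity for a single weight; \<open>c\<close> stands for the constant
  factor \<open>abar j\<close>.\<close>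

lemma density_involution_min:
  assumes M: "sigma_finite_measure M"
    and S[measurable]: "S \<in> M \<rightarrow>\<^sub>M M"
    and inv: "\<And>z. z \<in> space M \<Longrightarrow> S (S z) = z"
    and D[measurable]: "D \<in> borel_measurable M"
    and dens: "density M D = distr M M S"
  shows "density (distr M M S) (\<lambda>z. c * min 1 (D (S z))) = density M (\<lambda>z. c * min 1 (D z))"
proof -
  have "density (distr M M S) (\<lambda>z. c * min 1 (D (S z)))
      = density M (\<lambda>z. D z * (c * min 1 (D (S z))))"
    unfolding dens[symmetric] by (rule density_density_eq) measurable
  \<comment> \<open>Almost everywhere, \<open>D z * min 1 (D (S z)) = min (D z) (D z * D (S z)) =
    min (D z) 1\<close>.\<close>
  also have "\<dots> = density M (\<lambda>z. c * min 1 (D z))"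
    using AE_involution_density[OF assms]
    by (intro density_cong)
      (auto simp: mult.left_commute[of "D _"] mult_min_ennreal[of "D _"] min.commute elim!: eventually_mono)
  finally show ?thesis .
qed

text \<open>By balance, \<open>a\<close> with respect to \<open>M\<close> may be traded for
  \<open>a\<close> composed with \<open>S\<close> with respect to the pushforward. Changing
  variables then composes once more with \<open>S\<close>, which restores \<open>a\<close> and
  leaves \<open>g (S z)\<close>.\<close>

lemma nn_integral_balanced_involution:
  fixes a g :: "'c \<Rightarrow> ennreal"
  assumes S[measurable]: "S \<in> M \<rightarrow>\<^sub>M M"
    and inv: "\<And>z. z \<in> space M \<Longrightarrow> S (S z) = z"
    and [measurable]: "a \<in> borel_measurable M" "g \<in> borel_measurable M"
    and bal: "density (distr M M S) (\<lambda>z. a (S z)) = density M a"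
  shows "(\<integral>\<^sup>+z. a z * g (S z) \<partial>M) = (\<integral>\<^sup>+z. a z * g z \<partial>M)"
proof -
  have "(\<integral>\<^sup>+z. a z * g z \<partial>M) = (\<integral>\<^sup>+z. g z \<partial>density M a)"
    by (simp add: nn_integral_density)
  also have "\<dots> = (\<integral>\<^sup>+z. a (S z) * g z \<partial>distr M M S)"
    by (subst bal[symmetric]) (simp add: nn_integral_density)
  also have "\<dots> = (\<integral>\<^sup>+z. a (S (S z)) * g (S z) \<partial>M)"
    by (rule nn_integral_distr) measurable
  also have "\<dots> = (\<integral>\<^sup>+z. a z * g (S z) \<partial>M)"
    by (intro nn_integral_cong) (simp add: inv)
  finally show ?thesis ..
qed

section \<open>Integrals and marginals of the joint measure\<close>

lemma sets_joint_measure: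
  assumes "mu \<in> space (prob_algebra X)" "V \<in> X \<rightarrow>\<^sub>M prob_algebra Y"
  shows "sets (joint_measure X Y mu V) = sets (X \<Otimes>\<^sub>M Y)"
  using joint_measure_in_prob_algebra[OF assms] by (simp add: space_prob_algebra)

text \<open>Turns iterated integrals over \<open>q\<close> and \<open>v\<close> into integrals over
  the product space, where the maps \<open>S j\<close> act and a change of variables is
  possible.\<close>

lemma nn_integral_joint_measure:
  assumes mu: "mu \<in> space (prob_algebra X)" and V[measurable]: "V \<in> X \<rightarrow>\<^sub>M prob_algebra Y"
    and f[measurable]: "f \<in> borel_measurable (X \<Otimes>\<^sub>M Y)"
  shows "(\<integral>\<^sup>+z. f z \<partial>joint_measure X Y mu V) = (\<integral>\<^sup>+q. \<integral>\<^sup>+v. f (q, v) \<partial>V q \<partial>mu)"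
proof -
  have mu_sets[measurable_cong]: "sets mu = sets X"
    using mu by (simp add: space_prob_algebra)
  have mu_space: "space mu = space X"
    using mu_sets by (rule sets_eq_imp_space_eq)
  have "(\<integral>\<^sup>+z. f z \<partial>joint_measure X Y mu V)
      = (\<integral>\<^sup>+q. \<integral>\<^sup>+z. f z \<partial>(V q \<bind> (\<lambda>v. return (X \<Otimes>\<^sub>M Y) (q, v))) \<partial>mu)"
    unfolding joint_measure_def
    by (rule nn_integral_bind[OF f]) (rule measurable_prob_algebraD, measurable)
  also have "\<dots> = (\<integral>\<^sup>+q. \<integral>\<^sup>+v. f (q, v) \<partial>V q \<partial>mu)"
  proof (rule nn_integral_cong)
    fix q assume "q \<in> space mu"
    then have q[measurable]: "q \<in> space X" by (simp add: mu_space)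
    have Vq[measurable_cong]: "sets (V q) = sets Y"
      using measurable_space[OF V q] by (simp add: space_prob_algebra)
    have [simp]: "space (V q) = space Y"
      using Vq by (rule sets_eq_imp_space_eq)
    have "(\<integral>\<^sup>+z. f z \<partial>(V q \<bind> (\<lambda>v. return (X \<Otimes>\<^sub>M Y) (q, v))))
        = (\<integral>\<^sup>+v. \<integral>\<^sup>+z. f z \<partial>return (X \<Otimes>\<^sub>M Y) (q, v) \<partial>V q)"
      by (rule nn_integral_bind[OF f]) (rule measurable_prob_algebraD, measurable)
    also have "\<dots> = (\<integral>\<^sup>+v. f (q, v) \<partial>V q)"
      using q by (intro nn_integral_cong nn_integral_return) (auto simp: space_pair_measure)
    finally show "(\<integral>\<^sup>+z. f z \<partial>(V q \<bind> (\<lambda>v. return (X \<Otimes>\<^sub>M Y) (q, v)))) = (\<integral>\<^sup>+v. f (q, v) \<partial>V q)" .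
  qed
  finally show ?thesis .
qed

lemma emeasure_joint_measure_Times:
  assumes mu: "mu \<in> space (prob_algebra X)" and V: "V \<in> X \<rightarrow>\<^sub>M prob_algebra Y"
    and A: "A \<in> sets X" and B: "B \<in> sets Y"
  shows "emeasure (joint_measure X Y mu V) (A \<times> B) = (\<integral>\<^sup>+q. indicator A q * emeasure (V q) B \<partial>mu)"
proof -
  have "(\<integral>\<^sup>+v. indicator (A \<times> B) (q, v) \<partial>V q) = indicator A q * emeasure (V q) B"
    if "q \<in> space mu" for q
  proof -
    have "q \<in> space X"
      using mu that by (auto simp: space_prob_algebra dest: sets_eq_imp_space_eq)
    then have "sets (V q) = sets Y"
      using measurable_space[OF V] by (simp add: space_prob_algebra)
    then show ?thesis
      using B by (simp add: indicator_times nn_integral_cmult)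
  qed
  then show ?thesis
    using A B by (subst emeasure_joint_measure[OF mu V]) (auto intro!: nn_integral_cong)
qed

lemma emeasure_joint_measure_Times_space:
  assumes mu: "mu \<in> space (prob_algebra X)" and V: "V \<in> X \<rightarrow>\<^sub>M prob_algebra Y"
    and A: "A \<in> sets X"
  shows "emeasure (joint_measure X Y mu V) (A \<times> space Y) = emeasure mu A"
proof -
  have mu': "sets mu = sets X" "space mu = space X"
    using mu by (auto simp: space_prob_algebra dest: sets_eq_imp_space_eq)
  have "emeasure (V q) (space Y) = 1" if "q \<in> space mu" for q
    using measurable_space[OF V, of q] that
    by (auto simp: space_prob_algebra mu' dest!: prob_space.emeasure_space_1 sets_eq_imp_space_eq)
  then have "(\<integral>\<^sup>+q. indicator A q * emeasure (V q) (space Y) \<partial>mu) = (\<integral>\<^sup>+q. indicator A q \<partial>mu)"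
    by (intro nn_integral_cong) simp
  then show ?thesis
    using A by (simp add: emeasure_joint_measure_Times[OF mu V] mu')
qed

text \<open>The first marginal of the joint measure is \<open>mu\<close>, the second is
  \<open>mu\<close> pushed through \<open>P\<close>. Symmetry under the swap of coordinates makes
  them equal.\<close>

lemma bind_detailed_balance:
  assumes mu: "mu \<in> space (prob_algebra X)" and P: "P \<in> X \<rightarrow>\<^sub>M prob_algebra X"
    and bal: "detailed_balance X mu P"
  shows "mu \<bind> P = mu"
proof -
  have mu': "sets mu = sets X" "space mu = space X"
    using mu by (auto simp: space_prob_algebra dest: sets_eq_imp_space_eq)
  let ?J = "joint_measure X X mu P"
  have J[measurable_cong]: "sets ?J = sets (X \<Otimes>\<^sub>M X)"
    by (rule sets_joint_measure[OF mu P])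
  have sets_bind_mu: "sets (mu \<bind> P) = sets X"
  proof (rule sets_bind)
    show "sets (P q) = sets X" if "q \<in> space mu" for q
      using measurable_space[OF P] that by (simp add: space_prob_algebra mu')
    \<comment> \<open>On an empty space \<open>bind\<close> has a default value that ignores the
      kernel; a probability measure rules this out.\<close>
    show "space mu \<noteq> {}"
      using mu by (auto simp: space_prob_algebra dest: prob_space.not_empty)
  qed
  show ?thesis
  proof (rule measure_eqI)
    show "sets (mu \<bind> P) = sets mu" by (simp add: sets_bind_mu mu')
    fix A assume "A \<in> sets (mu \<bind> P)"
    then have A[measurable]: "A \<in> sets X" by (simp add: sets_bind_mu)
    have "emeasure (mu \<bind> P) A = (\<integral>\<^sup>+q. emeasure (P q) A \<partial>mu)"
      by (rule emeasure_bind_prob_algebra[OF mu P A])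
    \<comment> \<open>The indicator is 1 on all of \<open>space mu\<close>; it gives the integrand
      the form of the rectangle formula.\<close>
    also have "\<dots> = (\<integral>\<^sup>+q. indicator (space X) q * emeasure (P q) A \<partial>mu)"
      by (intro nn_integral_cong) (simp add: mu')
    also have "\<dots> = emeasure ?J (space X \<times> A)"
      by (simp add: emeasure_joint_measure_Times[OF mu P])
    also have "\<dots> = emeasure (distr ?J (X \<Otimes>\<^sub>M X) (\<lambda>(x, y). (y, x))) (space X \<times> A)"
      using bal by (simp add: detailed_balance_def)
    also have "\<dots> = emeasure ?J ((\<lambda>(x, y). (y, x)) -` (space X \<times> A) \<inter> space ?J)"
      by (rule emeasure_distr) measurable
    also have "(\<lambda>(x, y). (y, x)) -` (space X \<times> A) \<inter> space ?J = A \<times> space X"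
      using sets.sets_into_space[OF A]
      by (auto simp: sets_eq_imp_space_eq[OF J] space_pair_measure)
    also have "emeasure ?J (A \<times> space X) = emeasure mu A"
      by (rule emeasure_joint_measure_Times_space[OF mu P A])
    finally show "emeasure (mu \<bind> P) A = emeasure mu A" .
  qed
qed

section \<open>The kernel \<open>P_kernel\<close> for general weights of total mass one\<close>

context
  fixes X :: "'a measure" and Y :: "'b measure" and V :: "'a \<Rightarrow> 'b measure" and p :: nat
    and S :: "nat \<Rightarrow> 'a \<times> 'b \<Rightarrow> 'a \<times> 'b" and \<alpha> :: "nat \<Rightarrow> 'a \<times> 'b \<Rightarrow> real"
  assumes V[measurable]: "V \<in> X \<rightarrow>\<^sub>M prob_algebra Y"
    and S[measurable]: "\<And>j. j \<le> p \<Longrightarrow> S j \<in> (X \<Otimes>\<^sub>M Y) \<rightarrow>\<^sub>M (X \<Otimes>\<^sub>M Y)"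
    and \<alpha>[measurable]: "\<And>j. j \<le> p \<Longrightarrow> \<alpha> j \<in> borel_measurable (X \<Otimes>\<^sub>M Y)"
    and total: "\<And>q. q \<in> space X \<Longrightarrow> (\<Sum>j=0..p. \<integral>\<^sup>+v. ennreal (\<alpha> j (q, v)) \<partial>V q) = 1"
begin

lemma measurable_P_kernel: "P_kernel X p \<alpha> S V \<in> X \<rightarrow>\<^sub>M prob_algebra X"
proof -
  have "prob_space (P_kernel X p \<alpha> S V q)" if q: "q \<in> space X" for q
  proof (rule prob_spaceI)
    have sp: "space (V q) = space Y"
      using measurable_space[OF V q] by (auto simp: space_prob_algebra dest: sets_eq_imp_space_eq)
    \<comment> \<open>A Dirac measure gives \<open>space X\<close> mass 1 only if its point lies
      there. The total mass of the kernel then reduces to the total of the weights.\<close>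
    have "fst (S j (q, v)) \<in> space X" if "j \<le> p" "v \<in> space Y" for j v
      using measurable_space[OF S[OF that(1)], of "(q, v)"] q that(2)
      by (auto simp: space_pair_measure)
    then have "emeasure (P_kernel X p \<alpha> S V q) (space X)
        = (\<Sum>j=0..p. \<integral>\<^sup>+v. ennreal (\<alpha> j (q, v)) \<partial>V q)"
      using S \<alpha> q by (subst emeasure_P_kernel[OF V]) (auto simp: sp intro!: sum.cong nn_integral_cong)
    then show "emeasure (P_kernel X p \<alpha> S V q) (space (P_kernel X p \<alpha> S V q)) = 1"
      using total[OF q] by (simp add: P_kernel_def)
  qed
  moreover have "(\<lambda>q. emeasure (P_kernel X p \<alpha> S V q) A) \<in> borel_measurable X"
    if A[measurable]: "A \<in> sets X" for A
  proof -
    \<comment> \<open>Here \<open>q\<close> enters both the integrand and the measure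
      \<open>V q\<close>, so joint measurability of the integrand in \<open>(q, v)\<close> is what
      must be shown.\<close>
    have "(\<lambda>q. \<integral>\<^sup>+v. ennreal (\<alpha> j (q, v)) * emeasure (return X (fst (S j (q, v)))) A \<partial>V q)
        \<in> borel_measurable X" if j: "j \<le> p" for j
    proof (rule nn_integral_measurable_subprob_algebra2[where N = Y])
      note S[OF j, measurable] \<alpha>[OF j, measurable]
      show "(\<lambda>(q, v). ennreal (\<alpha> j (q, v)) * emeasure (return X (fst (S j (q, v)))) A)
          \<in> borel_measurable (X \<Otimes>\<^sub>M Y)"
        by (simp add: split_beta')
      show "V \<in> X \<rightarrow>\<^sub>M subprob_algebra Y"
        by (rule measurable_prob_algebraD[OF V])
    qed
    then have "(\<lambda>q. \<Sum>j=0..p. \<integral>\<^sup>+v. ennreal (\<alpha> j (q, v)) *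
        emeasure (return X (fst (S j (q, v)))) A \<partial>V q) \<in> borel_measurable X"
      by (intro borel_measurable_sum) auto
    then show ?thesis
      using S \<alpha> A by (subst measurable_cong[OF emeasure_P_kernel[OF V]]) auto
  qed
  ultimately show ?thesis
    by (auto simp: markov_kernel_iff P_kernel_def)
qed

text \<open>Given \<open>q\<close> and \<open>v\<close>, the j-th proposal moves to the first
  coordinate of \<open>S j (q, v)\<close> with weight \<open>\<alpha> j (q, v)\<close>. Integrating
  over both variables expresses the law of a transition through the joint measure on which
  \<open>S j\<close> acts.\<close>

lemma emeasure_joint_measure_P_kernel:
  assumes mu: "mu \<in> space (prob_algebra X)" and E[measurable]: "E \<in> sets (X \<Otimes>\<^sub>M X)"
  shows "emeasure (joint_measure X X mu (P_kernel X p \<alpha> S V)) E =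
    (\<Sum>j=0..p. \<integral>\<^sup>+z. ennreal (\<alpha> j z) * indicator E (fst z, fst (S j z)) \<partial>joint_measure X Y mu V)"
proof -
  let ?P = "P_kernel X p \<alpha> S V"
  have mu_sets[measurable_cong]: "sets mu = sets X" and mu_space: "space mu = space X"
    using mu by (auto simp: space_prob_algebra dest: sets_eq_imp_space_eq)
  have f: "(\<lambda>z. ennreal (\<alpha> j z) * indicator E (fst z, fst (S j z))) \<in> borel_measurable (X \<Otimes>\<^sub>M Y)"
    if j: "j \<le> p" for j
  proof -
    note S[OF j, measurable] \<alpha>[OF j, measurable]
    show ?thesis by measurable
  qed
  have "emeasure (joint_measure X X mu ?P) E = (\<integral>\<^sup>+q. \<integral>\<^sup>+x. indicator E (q, x) \<partial>?P q \<partial>mu)"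
    by (rule emeasure_joint_measure[OF mu measurable_P_kernel E])
  also have "\<dots> = (\<integral>\<^sup>+q. (\<Sum>j=0..p. \<integral>\<^sup>+v. ennreal (\<alpha> j (q, v)) *
      indicator E (q, fst (S j (q, v))) \<partial>V q) \<partial>mu)"
  proof (rule nn_integral_cong)
    fix q assume "q \<in> space mu"
    then have q: "q \<in> space X" by (simp add: mu_space)
    \<comment> \<open>The section of \<open>E\<close> at \<open>q\<close> is the set that the
      measure at \<open>q\<close> has to evaluate; a Dirac mass on it is again an indicator of
      \<open>E\<close>.\<close>
    have Eq: "Pair q -` E \<in> sets X" by (rule sets_Pair1[OF E])
    have "(\<integral>\<^sup>+x. indicator E (q, x) \<partial>?P q) = (\<integral>\<^sup>+x. indicator (Pair q -` E) x \<partial>?P q)"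
      by (intro nn_integral_cong) (auto simp: indicator_def)
    also have "\<dots> = emeasure (?P q) (Pair q -` E)"
      using Eq by (simp add: P_kernel_def)
    also have "\<dots> = (\<Sum>j=0..p. \<integral>\<^sup>+v. ennreal (\<alpha> j (q, v)) *
        indicator E (q, fst (S j (q, v))) \<partial>V q)"
      using S \<alpha> q Eq
      by (subst emeasure_P_kernel[OF V])
        (auto simp: indicator_def intro!: sum.cong nn_integral_cong)
    finally show "(\<integral>\<^sup>+x. indicator E (q, x) \<partial>?P q) = \<dots>" .
  qed
  also have "\<dots> = (\<Sum>j=0..p. \<integral>\<^sup>+q. \<integral>\<^sup>+v. ennreal (\<alpha> j (q, v)) *
      indicator E (q, fst (S j (q, v))) \<partial>V q \<partial>mu)"
  proof (rule nn_integral_sum)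
    fix j assume "j \<in> {0..p}"
    then have "(\<lambda>(q, v). ennreal (\<alpha> j (q, v)) * indicator E (q, fst (S j (q, v))))
        \<in> borel_measurable (X \<Otimes>\<^sub>M Y)"
      using f[of j] by (simp add: split_beta')
    then have "(\<lambda>q. \<integral>\<^sup>+v. ennreal (\<alpha> j (q, v)) * indicator E (q, fst (S j (q, v))) \<partial>V q)
        \<in> borel_measurable X"
      by (rule nn_integral_measurable_subprob_algebra2[OF _ measurable_prob_algebraD[OF V]])
    then show "(\<lambda>q. \<integral>\<^sup>+v. ennreal (\<alpha> j (q, v)) * indicator E (q, fst (S j (q, v))) \<partial>V q)
        \<in> borel_measurable mu"
      by simp
  qed
  also have "\<dots> = (\<Sum>j=0..p. \<integral>\<^sup>+z. ennreal (\<alpha> j z) * indicator E (fst z, fst (S j z))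
      \<partial>joint_measure X Y mu V)"
    using f by (intro sum.cong refl) (simp add: nn_integral_joint_measure[OF mu V])
  finally show ?thesis .
qed

text \<open>Symmetry already holds for each \<open>j\<close> separately: applying \<open>S j\<close>
  exchanges the start and end points of a move, and balance says that the weighted measure is
  unchanged by this. The special form of the weights enters only through \<open>bal\<close>.\<close>

lemma detailed_balance_P_kernel:
  assumes mu: "mu \<in> space (prob_algebra X)"
    and inv: "\<And>j z. j \<le> p \<Longrightarrow> z \<in> space (X \<Otimes>\<^sub>M Y) \<Longrightarrow> S j (S j z) = z"
    and bal: "\<And>j. j \<le> p \<Longrightarrow>
      density (distr (joint_measure X Y mu V) (X \<Otimes>\<^sub>M Y) (S j)) (\<lambda>z. ennreal (\<alpha> j (S j z)))
      = density (joint_measure X Y mu V) (\<lambda>z. ennreal (\<alpha> j z))"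
  shows "detailed_balance X mu (P_kernel X p \<alpha> S V)"
proof -
  let ?J = "joint_measure X X mu (P_kernel X p \<alpha> S V)" and ?M = "joint_measure X Y mu V"
  have J[measurable_cong]: "sets ?J = sets (X \<Otimes>\<^sub>M X)"
    by (rule sets_joint_measure[OF mu measurable_P_kernel])
  have M[measurable_cong]: "sets ?M = sets (X \<Otimes>\<^sub>M Y)"
    by (rule sets_joint_measure[OF mu V])
  show ?thesis
    unfolding detailed_balance_def
  proof (rule measure_eqI)
    show "sets ?J = sets (distr ?J (X \<Otimes>\<^sub>M X) (\<lambda>(x, y). (y, x)))"
      by (simp add: J)
    fix E assume "E \<in> sets ?J"
    then have E[measurable]: "E \<in> sets (X \<Otimes>\<^sub>M X)" by (simp add: J)
    let ?E = "(\<lambda>(x, y). (y, x)) -` E \<inter> space (X \<Otimes>\<^sub>M X)"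
    have E'[measurable]: "?E \<in> sets (X \<Otimes>\<^sub>M X)" by measurable
    have "(\<integral>\<^sup>+z. ennreal (\<alpha> j z) * indicator ?E (fst z, fst (S j z)) \<partial>?M)
        = (\<integral>\<^sup>+z. ennreal (\<alpha> j z) * indicator E (fst z, fst (S j z)) \<partial>?M)" if j: "j \<le> p" for j
    proof -
      note S[OF j, measurable] \<alpha>[OF j, measurable]
      have S_space: "S j z \<in> space (X \<Otimes>\<^sub>M Y)" if "z \<in> space (X \<Otimes>\<^sub>M Y)" for z
        using measurable_space[OF S[OF j] that] .
      \<comment> \<open>A pushforward depends on its target only through the sigma-algebra, so
        \<open>M\<close> itself can serve as the target, as the lemma on involutions
        requires.\<close>
      have bal': "density (distr ?M ?M (S j)) (\<lambda>z. ennreal (\<alpha> j (S j z)))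
          = density ?M (\<lambda>z. ennreal (\<alpha> j z))"
        using bal[OF j] distr_cong[OF refl M, of ?M "S j" "S j"] by simp
      \<comment> \<open>Since \<open>S j (S j z) = z\<close>, the indicator of the swapped set is
        the function \<open>g\<close> given below, evaluated at \<open>S j z\<close>.\<close>
      have "(\<integral>\<^sup>+z. ennreal (\<alpha> j z) * indicator ?E (fst z, fst (S j z)) \<partial>?M)
          = (\<integral>\<^sup>+z. ennreal (\<alpha> j z) * indicator E (fst (S j z), fst (S j (S j z))) \<partial>?M)"
        using S_space inv[OF j]
        by (intro nn_integral_cong)
          (auto simp: sets_eq_imp_space_eq[OF M] space_pair_measure indicator_def mem_Times_iff)
      also have "\<dots> = (\<integral>\<^sup>+z. ennreal (\<alpha> j z) * indicator E (fst z, fst (S j z)) \<partial>?M)"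
        using inv[OF j]
        by (intro nn_integral_balanced_involution[OF _ _ _ _ bal',
              where g = "\<lambda>z. indicator E (fst z, fst (S j z))"])
          (auto simp: sets_eq_imp_space_eq[OF M])
      finally show ?thesis .
    qed
    then have "emeasure ?J ?E = emeasure ?J E"
      by (simp add: emeasure_joint_measure_P_kernel[OF mu])
    then show "emeasure ?J E = emeasure (distr ?J (X \<Otimes>\<^sub>M X) (\<lambda>(x, y). (y, x))) E"
      by (subst emeasure_distr) (auto simp: sets_eq_imp_space_eq[OF J])
  qed
qed

end

section \<open>The truncated Radon-Nikodym weights and the final result\<close>

theorem corollary2p6:
  fixes X :: "'a measure" and Y :: "'b measure" and mu :: "'a measure"
    and V :: "'a \<Rightarrow> 'b measure" and M :: "('a \<times> 'b) measure"
    and p :: nat and S :: "nat \<Rightarrow> 'a \<times> 'b \<Rightarrow> 'a \<times> 'b"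
    and abar :: "nat \<Rightarrow> real" and D :: "nat \<Rightarrow> 'a \<times> 'b \<Rightarrow> ennreal"
    and \<alpha> :: "nat \<Rightarrow> 'a \<times> 'b \<Rightarrow> real" and P :: "'a \<Rightarrow> 'a measure"
  assumes mu: "mu \<in> space (prob_algebra X)"
    and V: "V \<in> X \<rightarrow>\<^sub>M prob_algebra Y"
    and M: "M = joint_measure X Y mu V"
    and p: "p \<ge> 1"
    and S0: "\<And>z. z \<in> space (X \<Otimes>\<^sub>M Y) \<Longrightarrow> S 0 z = z"
    and S_meas: "\<And>j. j \<in> {1..p} \<Longrightarrow> S j \<in> (X \<Otimes>\<^sub>M Y) \<rightarrow>\<^sub>M (X \<Otimes>\<^sub>M Y)"
    and S_inv: "\<And>j z. j \<in> {1..p} \<Longrightarrow> z \<in> space (X \<Otimes>\<^sub>M Y) \<Longrightarrow> S j (S j z) = z"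
    and S_ac: "\<And>j. j \<in> {1..p} \<Longrightarrow> absolutely_continuous M (distr M (X \<Otimes>\<^sub>M Y) (S j))"
    and abar_nonneg: "\<And>j. j \<in> {1..p} \<Longrightarrow> abar j \<ge> 0"
    and abar_sum: "(\<Sum>j=1..p. abar j) \<le> 1"
    and D: "\<And>j. j \<in> {1..p} \<Longrightarrow> RN_version M (distr M (X \<Otimes>\<^sub>M Y) (S j)) (D j)"
    and \<alpha>: "\<alpha> = accept_prob p abar D"
    and P: "P = P_kernel X p \<alpha> S V"
  shows "(\<forall>j\<in>{0..p}. \<forall>z\<in>space (X \<Otimes>\<^sub>M Y). \<alpha> j z \<in> {0..1}) \<and>
    (\<forall>q\<in>space X. (\<Sum>j=0..p. \<integral>\<^sup>+v. ennreal (\<alpha> j (q, v)) \<partial>V q) = 1) \<and>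
    (\<forall>j\<in>{0..p}. density (distr M (X \<Otimes>\<^sub>M Y) (S j)) (\<lambda>z. ennreal (\<alpha> j (S j z)))
                 = density M (\<lambda>z. ennreal (\<alpha> j z))) \<and>
    (\<forall>A\<in>sets X. (\<Sum>j=0..p. \<integral>\<^sup>+z\<in>A \<times> space Y. ennreal (\<alpha> j (S j z))
                     \<partial>distr M (X \<Otimes>\<^sub>M Y) (S j)) = emeasure mu A) \<and>
    P \<in> X \<rightarrow>\<^sub>M prob_algebra X \<and>
    detailed_balance X mu P \<and>
    mu \<bind> P = mu"
proof -
  let ?Z = "X \<Otimes>\<^sub>M Y"
  have M_prob: "M \<in> space (prob_algebra ?Z)"
    unfolding M by (rule joint_measure_in_prob_algebra[OF mu V])
  then have M_sets[measurable_cong]: "sets M = sets ?Z" and "prob_space M"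
    by (auto simp: space_prob_algebra)
  interpret M: prob_space M by fact
  have M_space: "space M = space ?Z"
    using M_sets by (rule sets_eq_imp_space_eq)
  \<comment> \<open>The lemmas on involutions concern self-maps of a single measure space, hence the
    change of target.\<close>
  have distr_M: "distr M ?Z f = distr M M f" for f
    by (rule distr_cong) (auto simp: M_sets)
  have S_meas': "S j \<in> ?Z \<rightarrow>\<^sub>M ?Z" if "j \<le> p" for j
  proof (cases "j = 0")
    case True
    \<comment> \<open>\<open>S 0\<close> is known to be the identity only on the space, which
      suffices for measurability.\<close>
    have "S 0 \<in> ?Z \<rightarrow>\<^sub>M ?Z \<longleftrightarrow> (\<lambda>z. z) \<in> ?Z \<rightarrow>\<^sub>M ?Z"
      by (rule measurable_cong) (rule S0)
    with True show ?thesis by simp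
  qed (use S_meas that in auto)
  have S_inv': "S j (S j z) = z" if "j \<le> p" "z \<in> space ?Z" for j z
    using that S0 S_inv[of j z] by (cases "j = 0") auto
  have D_meas: "D j \<in> borel_measurable ?Z" and D_dens: "density M (D j) = distr M M (S j)"
    if "j \<in> {1..p}" for j
    using D[OF that] measurable_cong_sets[OF M_sets refl]
    by (auto simp: RN_version_def distr_M)
  have r: "enn2real (min 1 x) \<in> {0..1}" for x
    using enn2real_mono[of "min 1 x" 1] by simp
  \<comment> \<open>This keeps \<open>\<alpha> 0\<close> nonnegative, so that \<open>ennreal\<close>
    does not truncate it to 0.\<close>
  have le: "(\<Sum>i=1..p. abar i * enn2real (min 1 (D i z))) \<le> 1" for z
  proof -
    have "(\<Sum>i=1..p. abar i * enn2real (min 1 (D i z))) \<le> (\<Sum>i=1..p. abar i)"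
      using r abar_nonneg by (intro sum_mono mult_left_le) auto
    with abar_sum show ?thesis by simp
  qed
  have abar_le: "abar j \<le> 1" if "j \<in> {1..p}" for j
    using member_le_sum[of j "{1..p}" abar] that abar_nonneg abar_sum by force
  have \<alpha>_range: "\<alpha> j z \<in> {0..1}" if "j \<le> p" for j z
  proof (cases "j = 0")
    case True
    have "0 \<le> (\<Sum>i=1..p. abar i * enn2real (min 1 (D i z)))"
      using abar_nonneg by (intro sum_nonneg) auto
    with True le[of z] show ?thesis by (simp add: \<alpha> accept_prob_def)
  next
    case False
    then have "0 \<le> abar j" "abar j \<le> 1" using that abar_nonneg[of j] abar_le[of j] by auto
    with False r[of "D j z"] show ?thesis by (auto simp: \<alpha> accept_prob_def intro!: mult_le_one)
  qed
  \<comment> \<open>Splitting off index 0 cancels the remaining terms, for every \<open>z\<close>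
    and not just almost everywhere.\<close>
  have \<alpha>_sum: "(\<Sum>j=0..p. \<alpha> j z) = 1" for z
    by (simp add: sum.atLeast_Suc_atMost \<alpha> accept_prob_def)
  have \<alpha>_ennsum: "(\<Sum>j=0..p. ennreal (\<alpha> j z)) = 1" for z
    using \<alpha>_range by (subst sum_ennreal) (auto simp: \<alpha>_sum)
  have \<alpha>_meas: "\<alpha> j \<in> borel_measurable ?Z" if "j \<le> p" for j
  proof (cases "j = 0")
    case True
    have "(\<lambda>z. 1 - (\<Sum>i=1..p. abar i * enn2real (min 1 (D i z)))) \<in> borel_measurable ?Z"
      using D_meas
      by (intro borel_measurable_diff borel_measurable_sum borel_measurable_times
          borel_measurable_const borel_measurable_enn2real borel_measurable_min) auto
    moreover have "\<alpha> j = (\<lambda>z. 1 - (\<Sum>i=1..p. abar i * enn2real (min 1 (D i z))))"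
      by (simp add: \<alpha> True accept_prob_def fun_eq_iff)
    ultimately show ?thesis by simp
  next
    case False
    then have [measurable]: "D j \<in> borel_measurable ?Z" using that D_meas by auto
    have "(\<lambda>z. abar j * enn2real (min 1 (D j z))) \<in> borel_measurable ?Z" by measurable
    moreover have "\<alpha> j = (\<lambda>z. abar j * enn2real (min 1 (D j z)))"
      by (simp add: \<alpha> False accept_prob_def fun_eq_iff)
    ultimately show ?thesis by simp
  qed
  have total: "(\<Sum>j=0..p. \<integral>\<^sup>+v. ennreal (\<alpha> j (q, v)) \<partial>V q) = 1" if q: "q \<in> space X" for q
  proof -
    have Vq[measurable_cong]: "sets (V q) = sets Y" and "prob_space (V q)"
      using measurable_space[OF V q] by (auto simp: space_prob_algebra)
    \<comment> \<open>With the finite sum moved inside the integral, the weights add up to the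
      constant 1, integrated against a probability measure.\<close>
    interpret Vq: prob_space "V q" by fact
    have "(\<lambda>v. \<alpha> j (q, v)) \<in> borel_measurable (V q)" if "j \<le> p" for j
      using measurable_compose[OF measurable_Pair1'[OF q] \<alpha>_meas[OF that]]
        measurable_cong_sets[OF Vq refl] by blast
    then have "(\<Sum>j=0..p. \<integral>\<^sup>+v. ennreal (\<alpha> j (q, v)) \<partial>V q)
        = (\<integral>\<^sup>+v. (\<Sum>j=0..p. ennreal (\<alpha> j (q, v))) \<partial>V q)"
      by (intro nn_integral_sum[symmetric]) auto
    also have "\<dots> = 1"
      by (simp add: \<alpha>_ennsum Vq.emeasure_space_1)
    finally show ?thesis .
  qed
  have bal: "density (distr M ?Z (S j)) (\<lambda>z. ennreal (\<alpha> j (S j z))) = density M (\<lambda>z. ennreal (\<alpha> j z))"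
    if j: "j \<le> p" for j
  proof (cases "j = 0")
    case True
    \<comment> \<open>For index 0 the map is the identity on the space, so balance is trivial
      whatever the weight.\<close>
    have "distr M M (S 0) = distr M M (\<lambda>z. z)"
      by (rule distr_cong) (auto simp: M_space S0)
    moreover have "(\<lambda>z. ennreal (\<alpha> 0 (S 0 z))) \<in> borel_measurable M"
      using measurable_compose[OF S_meas'[of 0] \<alpha>_meas[of 0]] measurable_cong_sets[OF M_sets refl]
      by auto
    moreover have "(\<lambda>z. ennreal (\<alpha> 0 z)) \<in> borel_measurable M"
      using \<alpha>_meas[of 0] measurable_cong_sets[OF M_sets refl] by auto
    ultimately show ?thesis
      by (auto simp: True distr_M distr_id2 M_space S0 intro!: density_cong)
  next
    case False
    with j have j': "j \<in> {1..p}" by auto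
    \<comment> \<open>The minimum with 1 is finite, so the passage through the reals loses nothing
      even where \<open>D j\<close> is infinite.\<close>
    have "ennreal (enn2real (min 1 (D j z))) = min 1 (D j z)" for z
      by (rule ennreal_enn2real) (simp add: min_less_iff_disj)
    then have eq: "ennreal (\<alpha> j z) = ennreal (abar j) * min 1 (D j z)" for z
      using False abar_nonneg[OF j'] by (simp add: \<alpha> accept_prob_def ennreal_mult)
    have "S j \<in> M \<rightarrow>\<^sub>M M" "D j \<in> borel_measurable M"
      using S_meas[OF j'] D_meas[OF j'] measurable_cong_sets[OF M_sets M_sets]
        measurable_cong_sets[OF M_sets refl] by auto
    then show ?thesis
      unfolding eq distr_M using S_inv[OF j'] D_dens[OF j']
      by (intro density_involution_min M.sigma_finite_measure_axioms) (auto simp: M_space)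
  qed
  \<comment> \<open>Balance replaces every term by an integral of \<open>\<alpha> j\<close> over the
    cylinder with respect to \<open>M\<close>. These weights sum to 1, which leaves the first
    marginal of \<open>M\<close>.\<close>
  have marginal: "(\<Sum>j=0..p. \<integral>\<^sup>+z\<in>A \<times> space Y. ennreal (\<alpha> j (S j z)) \<partial>distr M ?Z (S j))
      = emeasure mu A" if A[measurable]: "A \<in> sets X" for A
  proof -
    have meas: "\<alpha> j \<in> borel_measurable M" if "j \<le> p" for j
      using \<alpha>_meas[OF that] measurable_cong_sets[OF M_sets refl] by auto
    have "(\<integral>\<^sup>+z\<in>A \<times> space Y. ennreal (\<alpha> j (S j z)) \<partial>distr M ?Z (S j))
        = (\<integral>\<^sup>+z\<in>A \<times> space Y. ennreal (\<alpha> j z) \<partial>M)" if j: "j \<le> p" for j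
    proof -
      note S_meas'[OF j, measurable] \<alpha>_meas[OF j, measurable]
      \<comment> \<open>Each set integral is read as the mass that a density gives to the cylinder,
        so that the equality of measures in \<open>bal\<close> applies.\<close>
      have "(\<integral>\<^sup>+z\<in>A \<times> space Y. ennreal (\<alpha> j (S j z)) \<partial>distr M ?Z (S j))
          = emeasure (density (distr M ?Z (S j)) (\<lambda>z. ennreal (\<alpha> j (S j z)))) (A \<times> space Y)"
        by (rule emeasure_density[symmetric]) measurable
      also have "\<dots> = (\<integral>\<^sup>+z\<in>A \<times> space Y. ennreal (\<alpha> j z) \<partial>M)"
        unfolding bal[OF j] by (rule emeasure_density) measurable
      finally show ?thesis .
    qed
    then have "(\<Sum>j=0..p. \<integral>\<^sup>+z\<in>A \<times> space Y. ennreal (\<alpha> j (S j z)) \<partial>distr M ?Z (S j))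
        = (\<Sum>j=0..p. \<integral>\<^sup>+z\<in>A \<times> space Y. ennreal (\<alpha> j z) \<partial>M)"
      by simp
    also have "\<dots> = (\<integral>\<^sup>+z. (\<Sum>j=0..p. ennreal (\<alpha> j z) * indicator (A \<times> space Y) z) \<partial>M)"
      using meas by (intro nn_integral_sum[symmetric]) auto
    also have "\<dots> = (\<integral>\<^sup>+z. indicator (A \<times> space Y) z \<partial>M)"
      by (simp add: sum_distrib_right[symmetric] \<alpha>_ennsum)
    also have "\<dots> = emeasure M (A \<times> space Y)"
      by (rule nn_integral_indicator) measurable
    also have "\<dots> = emeasure mu A"
      unfolding M by (rule emeasure_joint_measure_Times_space[OF mu V A])
    finally show ?thesis .
  qed
  have P_meas: "P \<in> X \<rightarrow>\<^sub>M prob_algebra X"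
    unfolding P by (rule measurable_P_kernel[OF V S_meas' \<alpha>_meas total])
  have P_bal: "detailed_balance X mu P"
    unfolding P
    by (rule detailed_balance_P_kernel[OF V S_meas' \<alpha>_meas total mu S_inv' bal[unfolded M]])
  show ?thesis
    using \<alpha>_range total bal marginal P_meas P_bal bind_detailed_balance[OF mu P_meas P_bal]
    by (intro conjI ballI) auto
qed

end
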